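(* For a matrix $M\in\mathcal S^n$, the following are equivalent: (i) $M\in\mathcal{CS}_+^{n*}$, i.e., $\sum_{i,j=1}^nM_{ij}\langle X_i,X_j\rangle\ge0$ for all $d\in\mathbb N$ and all $X_1,\dots,X_n\in\mathcal S^d_+$. (ii) $\mathrm{Tr}\big(\sum_{i,j=1}^nM_{ij}X_i^2X_j^2\big)\ge0$ for all $d\in\mathbb N$ and all $X_1,\dots,X_n\in\mathcal S^d$.
   Context: $\mathcal S^d$ denotes the real symmetric $d\times d$ matrices with trace inner product $\langle X,Y\rangle=\mathrm{Tr}(XY)$, and $\mathcal S^d_+$ the positive semidefinite ones. $\mathcal{CS}_+^n$ is the set of $A\in\mathcal S^n$ for which there exist $d\ge1$ and $X_1,\dots,X_n\in\mathcal S^d_+$ with $A_{ij}=\langle X_i,X_j\rangle$ for all $i,j$. Its dual cone is $\mathcal{CS}_+^{n*}=\{M\in\mathcal S^n:\langle M,A\rangle\ge0\ \forall A\in\mathcal{CS}_+^n\}$. *)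

theory Defs
  imports Complex_Main "Jordan_Normal_Form.Matrix"
begin

text \<open>Matrices of size \<open>d\<close> are elements of \<^term>\<open>carrier_mat d d\<close>, so that \<open>d\<close> can be quantified
  inside a formula. Indices range over \<open>0, \<dots>, d - 1\<close>.\<close>

definition symmetric_mats :: "nat \<Rightarrow> real mat set" where
  "symmetric_mats d = {X \<in> carrier_mat d d. transpose_mat X = X}"

definition psd_mats :: "nat \<Rightarrow> real mat set" where
  "psd_mats d = {X \<in> symmetric_mats d. \<forall>v \<in> carrier_vec d. v \<bullet> (X *\<^sub>v v) \<ge> 0}"

definition mat_trace :: "real mat \<Rightarrow> real" where
  "mat_trace A = (\<Sum>k < dim_row A. A $$ (k, k))"

definition trace_inner :: "real mat \<Rightarrow> real mat \<Rightarrow> real" where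
  "trace_inner X Y = mat_trace (X * Y)"

definition cpsd_cone :: "nat \<Rightarrow> real mat set" where
  "cpsd_cone n = {A \<in> symmetric_mats n. \<exists>d \<ge> 1. \<exists>X :: nat \<Rightarrow> real mat.
     (\<forall>i < n. X i \<in> psd_mats d) \<and>
     (\<forall>i < n. \<forall>j < n. A $$ (i, j) = trace_inner (X i) (X j))}"

definition cpsd_dual_cone :: "nat \<Rightarrow> real mat set" where
  "cpsd_dual_cone n = {M \<in> symmetric_mats n. \<forall>A \<in> cpsd_cone n. trace_inner M A \<ge> 0}"

text \<open>The type \<^typ>\<open>real mat\<close> has no global zero matrix, so sums of \<open>d \<times> d\<close> matrices are taken
  in the additive group of \<^term>\<open>module_mat TYPE(real) d d\<close>.\<close>

definition mat_sum :: "nat \<Rightarrow> ('a \<Rightarrow> real mat) \<Rightarrow> 'a set \<Rightarrow> real mat" where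
  "mat_sum d f I = finsum (module_mat TYPE(real) d d) f I"

end

theory Submission
  imports Defs "HOL-Computational_Algebra.Formal_Power_Series"
begin

text \<open>The two conditions differ by the substitution of \<open>X\<^sub>i\<^sup>2\<close> for \<open>X\<^sub>i\<close>, so everything rests on the fact
  that the squares of symmetric matrices are exactly the positive semidefinite matrices. For the
  square root of a positive semidefinite \<open>A\<close>, write \<open>A = c (I - B)\<close> with \<open>0 \<le> B \<le> I\<close>. The binomial
  series of \<open>(1 - x)\<^bsup>1/2\<^esup>\<close> converges absolutely at \<open>x = 1\<close> and the entries of the powers of \<open>B\<close> are
  bounded by 1, so the series may be evaluated entrywise at \<open>B\<close>; the Cauchy product of the series
  with itself gives \<open>I - B\<close>. This avoids the spectral theorem.\<close>

section \<open>The binomial series with exponent one half\<close>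

text \<open>The coefficient of x^k in (1 - x)^(1/2); the sign is absorbed so that the series is
  evaluated at B itself.\<close>

definition sqrt_coeff :: "nat \<Rightarrow> real" where
  "sqrt_coeff k = (1/2 gchoose k) * (-1) ^ k"

lemma sqrt_coeff_pochhammer: "sqrt_coeff k = pochhammer (-1/2) k / fact k"
  by (simp add: sqrt_coeff_def gbinomial_pochhammer power_mult_distrib[symmetric])

text \<open>In the rising factorial of -1/2 only the first factor is negative; the others form a
  rising factorial of 1/2.\<close>

lemma sqrt_coeff_nonpos:
  assumes "k > 0"
  shows "sqrt_coeff k \<le> 0"
proof -
  obtain m where k: "k = Suc m" using assms gr0_conv_Suc by blast
  have "pochhammer (1/2 :: real) m \<ge> 0" by (rule pochhammer_nonneg) simp
  then show ?thesis
    by (simp add: sqrt_coeff_pochhammer k pochhammer_rec divide_nonpos_pos)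
qed

text \<open>Partial sums are the coefficients of (1 - x)^(1/2) / (1 - x) = (1 - x)^(-1/2), which are
  rising factorials of 1/2 over factorials.\<close>

lemma sum_sqrt_coeff_nonneg: "(\<Sum>k\<le>m. sqrt_coeff k) \<ge> 0"
proof -
  have "(\<Sum>k\<le>m. sqrt_coeff k) = (-1) ^ m * ((1/2 - 1 :: real) gchoose m)"
    unfolding sqrt_coeff_def by (rule gbinomial_sum_lower_neg)
  also have "\<dots> = pochhammer (1/2) m / fact m"
    by (simp add: gbinomial_pochhammer power_mult_distrib[symmetric])
  also have "\<dots> \<ge> 0"
    by (intro divide_nonneg_nonneg pochhammer_nonneg) simp_all
  finally show ?thesis .
qed

text \<open>Only the constant term 1 is positive, so the absolute values up to m add up to 2 minus
  the m-th partial sum. Nonnegativity of that partial sum bounds them by 2.\<close>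

lemma summable_abs_sqrt_coeff: "summable (\<lambda>k. \<bar>sqrt_coeff k\<bar>)"
proof (rule bounded_imp_summable)
  fix m
  have "(\<Sum>k\<le>m. \<bar>sqrt_coeff k\<bar>) = \<bar>sqrt_coeff 0\<bar> + (\<Sum>k=1..m. \<bar>sqrt_coeff k\<bar>)"
    by (simp add: sum.atMost_shift sum.atLeast1_atMost_eq lessThan_Suc_atMost)
  also have "(\<Sum>k=1..m. \<bar>sqrt_coeff k\<bar>) = (\<Sum>k=1..m. - sqrt_coeff k)"
    using sqrt_coeff_nonpos by (intro sum.cong) auto
  also have "\<bar>sqrt_coeff 0\<bar> + \<dots> = 2 - (\<Sum>k\<le>m. sqrt_coeff k)"
    by (simp add: sum.atMost_shift sum.atLeast1_atMost_eq sum_negf sqrt_coeff_def)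
  also have "\<dots> \<le> 2"
    using sum_sqrt_coeff_nonneg[of m] by simp
  finally show "(\<Sum>k\<le>m. \<bar>sqrt_coeff k\<bar>) \<le> 2" .
qed simp

text \<open>Vandermonde's identity adds the exponents 1/2 + 1/2 = 1, which leaves the coefficients
  of 1 - x.\<close>

lemma sqrt_coeff_convolution:
  "(\<Sum>i\<le>k. sqrt_coeff i * sqrt_coeff (k - i)) = (if k = 0 then 1 else if k = 1 then -1 else 0)"
proof -
  have "(\<Sum>i\<le>k. sqrt_coeff i * sqrt_coeff (k - i))
      = (\<Sum>i\<le>k. (1/2 gchoose i) * (1/2 gchoose (k - i)) * (-1) ^ k)"
  proof (intro sum.cong refl)
    fix i assume "i \<in> {..k}"
    \<comment> \<open>Here i is at most k, so the truncated subtraction \<open>k - i\<close> is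
      exact.\<close>
    then have "(-1 :: real) ^ i * (-1) ^ (k - i) = (-1) ^ k"
      by (simp flip: power_add)
    then show "sqrt_coeff i * sqrt_coeff (k - i)
        = (1/2 gchoose i) * (1/2 gchoose (k - i)) * (-1) ^ k"
      unfolding sqrt_coeff_def by (metis (no_types, opaque_lifting) mult.assoc mult.commute)
  qed
  also have "\<dots> = (1/2 + 1/2 gchoose k) * (-1) ^ k"
    unfolding sum_distrib_right[symmetric] gbinomial_Vandermonde[symmetric] atMost_atLeast0 ..
  also have "(1/2 + 1/2 gchoose k :: real) = of_nat (1 choose k)"
    by (simp add: binomial_gbinomial)
  also have "\<dots> * (-1) ^ k = (if k = 0 then 1 else if k = 1 then -1 else 0)"
    by (cases k rule: nat.exhaust; cases "k - 1") auto
  finally show ?thesis .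
qed

section \<open>Symmetric contractions\<close>

lemma pow_mat_Suc_left:
  assumes "B \<in> carrier_mat d d"
  shows "B ^\<^sub>m Suc k = B * B ^\<^sub>m k"
proof (induction k)
  case 0
  then show ?case using assms by simp
next
  case (Suc k)
  have "B ^\<^sub>m Suc (Suc k) = (B * B ^\<^sub>m k) * B"
    using Suc.IH by simp
  also have "\<dots> = B * (B ^\<^sub>m k * B)"
    using assms by (intro assoc_mult_mat) auto
  finally show ?case by simp
qed

lemma pow_mat_add:
  assumes "B \<in> carrier_mat d d"
  shows "B ^\<^sub>m (k + l) = B ^\<^sub>m k * B ^\<^sub>m l"
proof (induction l)
  case 0
  then show ?case using assms by (simp add: right_mult_one_mat[of _ d d])
next
  case (Suc l)
  have "B ^\<^sub>m (k + Suc l) = (B ^\<^sub>m k * B ^\<^sub>m l) * B"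
    using Suc.IH by simp
  also have "\<dots> = B ^\<^sub>m k * (B ^\<^sub>m l * B)"
    using assms by (intro assoc_mult_mat) auto
  finally show ?case by simp
qed

lemma symmetric_mats_pow:
  assumes "B \<in> symmetric_mats d"
  shows "B ^\<^sub>m k \<in> symmetric_mats d"
proof -
  have B: "B \<in> carrier_mat d d" "transpose_mat B = B"
    using assms by (auto simp: symmetric_mats_def)
  have "transpose_mat (B ^\<^sub>m k) = B ^\<^sub>m k"
  proof (induction k)
    case 0
    then show ?case by simp
  next
    case (Suc k)
    have "transpose_mat (B ^\<^sub>m k * B) = transpose_mat B * transpose_mat (B ^\<^sub>m k)"
      using B(1) by (intro transpose_mult) auto
    then show ?case using Suc.IH B pow_mat_Suc_left[OF B(1)] by simp
  qed
  then show ?thesis using B by (simp add: symmetric_mats_def)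
qed

lemma symmetric_mats_index:
  assumes "A \<in> symmetric_mats d" "i < d" "j < d"
  shows "A $$ (i, j) = A $$ (j, i)"
proof -
  have A: "A \<in> carrier_mat d d" "transpose_mat A = A"
    using assms(1) by (auto simp: symmetric_mats_def)
  have "transpose_mat A $$ (i, j) = A $$ (j, i)"
    using A(1) assms(2,3) by auto
  then show ?thesis by (simp add: A(2))
qed

lemma symmetric_mats_scalar_prod:
  assumes "B \<in> symmetric_mats d" "v \<in> carrier_vec d" "w \<in> carrier_vec d"
  shows "(B *\<^sub>v v) \<bullet> w = v \<bullet> (B *\<^sub>v w)"
  using transpose_vec_mult_scalar[of B d d w v] assms by (auto simp: symmetric_mats_def)

lemma scalar_prod_self_nonneg: "v \<bullet> v \<ge> (0 :: real)"
  by (simp add: scalar_prod_def sum_nonneg)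

text \<open>From 0 \<le> B \<le> I it follows that B is a contraction; three evaluations of the
  quadratic form replace an eigenvalue argument.\<close>

lemma norm_mult_mat_vec_le:
  assumes B: "B \<in> psd_mats d"
    and le: "\<And>v. v \<in> carrier_vec d \<Longrightarrow> v \<bullet> (B *\<^sub>v v) \<le> v \<bullet> v"
    and v: "v \<in> carrier_vec d"
  shows "(B *\<^sub>v v) \<bullet> (B *\<^sub>v v) \<le> v \<bullet> v"
proof -
  have sym: "B \<in> symmetric_mats d" and car: "B \<in> carrier_mat d d"
    using B by (auto simp: psd_mats_def symmetric_mats_def)
  define w where "w = B *\<^sub>v v"
  define z where "z = B *\<^sub>v w"
  have w: "w \<in> carrier_vec d" and z: "z \<in> carrier_vec d"
    using car v by (auto simp: w_def z_def)
  \<comment> \<open>Positivity at v - Bv yields 0 \<le> v.w - 2 w.w + w.Bw. The upper bound on the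
    form, taken at w and at v, turns the right side into v.v - w.w.\<close>
  have "0 \<le> (v - w) \<bullet> (B *\<^sub>v (v - w))"
    using B v w by (auto simp: psd_mats_def)
  also have "B *\<^sub>v (v - w) = w - z"
    using car v w by (simp add: mult_minus_distrib_mat_vec w_def z_def)
  also have "(v - w) \<bullet> (w - z) = v \<bullet> w - v \<bullet> z - w \<bullet> w + w \<bullet> z"
    using v w z by (simp add: minus_scalar_prod_distrib[of _ d] scalar_prod_minus_distrib[of _ d])
  also have "v \<bullet> z = w \<bullet> w"
    using symmetric_mats_scalar_prod[OF sym v w] by (simp add: w_def z_def)
  finally have "0 \<le> v \<bullet> w - w \<bullet> w - w \<bullet> w + w \<bullet> z" .
  moreover have "w \<bullet> z \<le> w \<bullet> w" using le[OF w] by (simp add: z_def)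
  moreover have "v \<bullet> w \<le> v \<bullet> v" using le[OF v] by (simp add: w_def)
  ultimately show ?thesis by (simp add: w_def)
qed

text \<open>Powers of a contraction are contractions. Column j of the power is the image of a unit
  vector, so its norm, and with it each of its entries, is at most 1.\<close>

lemma abs_pow_mat_index_le_1:
  assumes B: "B \<in> psd_mats d"
    and le: "\<And>v. v \<in> carrier_vec d \<Longrightarrow> v \<bullet> (B *\<^sub>v v) \<le> v \<bullet> v"
    and i: "i < d" and j: "j < d"
  shows "\<bar>(B ^\<^sub>m k) $$ (i, j)\<bar> \<le> 1"
proof -
  have car: "B \<in> carrier_mat d d"
    using B by (auto simp: psd_mats_def symmetric_mats_def)
  have "((B ^\<^sub>m k) *\<^sub>v v) \<bullet> ((B ^\<^sub>m k) *\<^sub>v v) \<le> v \<bullet> v" if v: "v \<in> carrier_vec d" for v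
  proof (induction k)
    case 0
    then show ?case using car v by simp
  next
    case (Suc k)
    have "(B ^\<^sub>m Suc k) *\<^sub>v v = B *\<^sub>v ((B ^\<^sub>m k) *\<^sub>v v)"
      unfolding pow_mat_Suc_left[OF car]
      using car v by (intro assoc_mult_mat_vec) auto
    moreover have "(B ^\<^sub>m k) *\<^sub>v v \<in> carrier_vec d"
      using car v by (intro mult_mat_vec_carrier) auto
    ultimately show ?case
      using norm_mult_mat_vec_le[OF B le] Suc.IH by fastforce
  qed
  from this[of "unit_vec d j"]
  have "(B ^\<^sub>m k *\<^sub>v unit_vec d j) \<bullet> (B ^\<^sub>m k *\<^sub>v unit_vec d j) \<le> 1"
    using j by simp
  moreover have "B ^\<^sub>m k *\<^sub>v unit_vec d j = col (B ^\<^sub>m k) j"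
    using car j by (intro eq_vecI) auto
  ultimately have "col (B ^\<^sub>m k) j \<bullet> col (B ^\<^sub>m k) j \<le> 1"
    by simp
  moreover have "((B ^\<^sub>m k) $$ (i, j))\<^sup>2 \<le> col (B ^\<^sub>m k) j \<bullet> col (B ^\<^sub>m k) j"
  proof -
    have "((B ^\<^sub>m k) $$ (i, j))\<^sup>2 \<le> (\<Sum>l \<in> {0..<d}. ((B ^\<^sub>m k) $$ (l, j))\<^sup>2)"
      using i by (intro member_le_sum) auto
    also have "\<dots> = col (B ^\<^sub>m k) j \<bullet> col (B ^\<^sub>m k) j"
      using car j by (auto simp: scalar_prod_def power2_eq_square intro!: sum.cong)
    finally show ?thesis .
  qed
  ultimately have "((B ^\<^sub>m k) $$ (i, j))\<^sup>2 \<le> 1" by linarith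
  then show ?thesis by (rule abs_square_le_1[THEN iffD1])
qed

section \<open>Square roots of positive semidefinite matrices\<close>

lemma ex_sqrt_one_minus:
  assumes B: "B \<in> psd_mats d"
    and le: "\<And>v. v \<in> carrier_vec d \<Longrightarrow> v \<bullet> (B *\<^sub>v v) \<le> v \<bullet> v"
  shows "\<exists>S \<in> symmetric_mats d. S * S = 1\<^sub>m d - B"
proof -
  have sym: "B \<in> symmetric_mats d" and car: "B \<in> carrier_mat d d"
    using B by (auto simp: psd_mats_def symmetric_mats_def)
  let ?f = "\<lambda>i j k. sqrt_coeff k * (B ^\<^sub>m k) $$ (i, j)"
  define S where "S = mat d d (\<lambda>(i, j). \<Sum>k. ?f i j k)"
  \<comment> \<open>Entries of powers are bounded by 1, so the series of absolute coefficients
    dominates every entry.\<close>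
  have summ: "summable (\<lambda>k. norm (?f i j k))" if "i < d" "j < d" for i j
  proof (rule summable_comparison_test'[OF summable_abs_sqrt_coeff])
    show "norm (norm (?f i j k)) \<le> \<bar>sqrt_coeff k\<bar>" for k
      using abs_pow_mat_index_le_1[OF B le that, of k] 
      by (simp add: abs_mult mult_left_le)
  qed
  have "(S * S) $$ (i, j) = (1\<^sub>m d - B) $$ (i, j)" if i: "i < d" and j: "j < d" for i j
  proof -
    \<comment> \<open>Each product of two entries of \<open>S\<close> is a product of absolutely
      convergent scalar series, hence the sum of their Cauchy product.\<close>
    have "(\<lambda>k. \<Sum>a\<le>k. ?f i l a * ?f l j (k - a)) sums (S $$ (i, l) * S $$ (l, j))" if "l < d" for l
      using Cauchy_product_sums[OF summ[OF i that] summ[OF that j]] i j that by (simp add: S_def)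
    then have "(\<lambda>k. \<Sum>l<d. \<Sum>a\<le>k. ?f i l a * ?f l j (k - a)) sums (\<Sum>l<d. S $$ (i, l) * S $$ (l, j))"
      by (intro sums_sum) auto
    also have "(\<Sum>l<d. S $$ (i, l) * S $$ (l, j)) = (S * S) $$ (i, j)"
      using i j by (simp add: S_def scalar_prod_def lessThan_atLeast0)
    also have "(\<lambda>k. \<Sum>l<d. \<Sum>a\<le>k. ?f i l a * ?f l j (k - a))
        = (\<lambda>k. (if k = 0 then 1 else if k = 1 then -1 else 0) * (B ^\<^sub>m k) $$ (i, j))"
    proof
      fix k
      \<comment> \<open>With l summed first, the entries reassemble into the product of the powers a
        and k - a of B. This is the k-th power whatever a is, so it factors out of the
        convolution.\<close>
      have "(\<Sum>l<d. \<Sum>a\<le>k. ?f i l a * ?f l j (k - a))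
          = (\<Sum>a\<le>k. \<Sum>l<d. ?f i l a * ?f l j (k - a))"
        by (rule sum.swap)
      also have "\<dots> = (\<Sum>a\<le>k. sqrt_coeff a * sqrt_coeff (k - a) * (B ^\<^sub>m k) $$ (i, j))"
      proof (intro sum.cong refl)
        fix a assume "a \<in> {..k}"
        then have "B ^\<^sub>m k = B ^\<^sub>m a * B ^\<^sub>m (k - a)"
          using pow_mat_add[OF car, of a "k - a"] by simp
        then have "(B ^\<^sub>m k) $$ (i, j) = (\<Sum>l<d. (B ^\<^sub>m a) $$ (i, l) * (B ^\<^sub>m (k - a)) $$ (l, j))"
          using car i j by (simp add: scalar_prod_def lessThan_atLeast0)
        then show "(\<Sum>l<d. ?f i l a * ?f l j (k - a))
            = sqrt_coeff a * sqrt_coeff (k - a) * (B ^\<^sub>m k) $$ (i, j)"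
          by (simp add: sum_distrib_left mult_ac)
      qed
      also have "\<dots> = (\<Sum>a\<le>k. sqrt_coeff a * sqrt_coeff (k - a)) * (B ^\<^sub>m k) $$ (i, j)"
        by (rule sum_distrib_right[symmetric])
      finally show "(\<Sum>l<d. \<Sum>a\<le>k. ?f i l a * ?f l j (k - a))
          = (if k = 0 then 1 else if k = 1 then -1 else 0) * (B ^\<^sub>m k) $$ (i, j)"
        unfolding sqrt_coeff_convolution .
    qed
    finally have "(\<lambda>k. (if k = 0 then 1 else if k = 1 then -1 else 0) * (B ^\<^sub>m k) $$ (i, j))
        sums ((S * S) $$ (i, j))" .
    \<comment> \<open>Only the terms k = 0 and k = 1 survive, and they give the entry of I - B;
      uniqueness of limits then identifies it with the entry of \<open>S * S\<close>.\<close>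
    moreover have "(\<lambda>k. (if k = 0 then 1 else if k = 1 then -1 else 0) * (B ^\<^sub>m k) $$ (i, j))
        sums (\<Sum>k\<in>{0,1}. (if k = 0 then 1 else if k = 1 then -1 else 0) * (B ^\<^sub>m k) $$ (i, j))"
      by (intro sums_finite) auto
    ultimately show ?thesis
      using car i j sums_unique2 by fastforce
  qed
  then have "S * S = 1\<^sub>m d - B"
    using car by (intro eq_matI) (auto simp: S_def)
  moreover have "S \<in> symmetric_mats d"
    using symmetric_mats_index[OF symmetric_mats_pow[OF sym]]
    by (auto simp: symmetric_mats_def S_def intro!: eq_matI)
  ultimately show ?thesis by blast
qed

lemma quadratic_form_bounded:
  fixes A :: "real mat"
  assumes A: "A \<in> carrier_mat d d"
  shows "\<exists>c > 0. \<forall>v \<in> carrier_vec d. v \<bullet> (A *\<^sub>v v) \<le> c * (v \<bullet> v)"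
proof (intro exI conjI ballI)
  \<comment> \<open>The summand 1 keeps the constant positive even when all entries vanish; it
    becomes a divisor in the rescaling of A.\<close>
  let ?c = "1 + (\<Sum>i<d. \<Sum>j<d. \<bar>A $$ (i, j)\<bar>)"
  show "?c > 0" by (intro add_pos_nonneg sum_nonneg) auto
  fix v :: "real vec" assume v: "v \<in> carrier_vec d"
  have sq: "(v $ i)\<^sup>2 \<le> v \<bullet> v" if "i < d" for i
  proof -
    have "(v $ i)\<^sup>2 \<le> (\<Sum>l\<in>{0..<d}. (v $ l)\<^sup>2)"
      using that by (intro member_le_sum) auto
    then show ?thesis using v by (simp add: scalar_prod_def power2_eq_square)
  qed
  have "v \<bullet> (A *\<^sub>v v) = (\<Sum>i<d. \<Sum>j<d. A $$ (i, j) * (v $ i * v $ j))"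
    using A v by (simp add: scalar_prod_def lessThan_atLeast0 sum_distrib_left mult_ac)
  also have "\<dots> \<le> (\<Sum>i<d. \<Sum>j<d. \<bar>A $$ (i, j)\<bar> * (v \<bullet> v))"
  proof (intro sum_mono)
    fix i j assume "i \<in> {..<d}" "j \<in> {..<d}"
    then have "(v $ i)\<^sup>2 \<le> v \<bullet> v" "(v $ j)\<^sup>2 \<le> v \<bullet> v" using sq by auto
    \<comment> \<open>By the arithmetic-geometric mean inequality, a product of two coordinates is
      at most the mean of their squares, hence at most v.v.\<close>
    moreover have "2 * \<bar>v $ i\<bar> * \<bar>v $ j\<bar> \<le> (v $ i)\<^sup>2 + (v $ j)\<^sup>2"
      using sum_squares_bound[of "\<bar>v $ i\<bar>" "\<bar>v $ j\<bar>"] by simp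
    ultimately have "\<bar>v $ i * v $ j\<bar> \<le> v \<bullet> v" by (simp add: abs_mult)
    then have "\<bar>A $$ (i, j) * (v $ i * v $ j)\<bar> \<le> \<bar>A $$ (i, j)\<bar> * (v \<bullet> v)"
      unfolding abs_mult[of "A $$ (i, j)"] by (rule mult_left_mono) simp
    then show "A $$ (i, j) * (v $ i * v $ j) \<le> \<bar>A $$ (i, j)\<bar> * (v \<bullet> v)" by linarith
  qed
  also have "\<dots> = (\<Sum>i<d. \<Sum>j<d. \<bar>A $$ (i, j)\<bar>) * (v \<bullet> v)"
    by (simp add: sum_distrib_right)
  also have "\<dots> \<le> ?c * (v \<bullet> v)"
    by (intro mult_right_mono scalar_prod_self_nonneg) simp
  finally show "v \<bullet> (A *\<^sub>v v) \<le> ?c * (v \<bullet> v)" .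
qed

lemma psd_mats_ex_sqrt:
  assumes A: "A \<in> psd_mats d"
  shows "\<exists>S \<in> symmetric_mats d. S * S = A"
proof -
  have sym: "A \<in> symmetric_mats d" and car: "A \<in> carrier_mat d d"
    using A by (auto simp: psd_mats_def symmetric_mats_def)
  obtain c where c: "c > 0" and bound: "\<And>v. v \<in> carrier_vec d \<Longrightarrow> v \<bullet> (A *\<^sub>v v) \<le> c * (v \<bullet> v)"
    using quadratic_form_bounded[OF car] by blast
  \<comment> \<open>The bound A \<le> cI makes B positive semidefinite, and A \<ge> 0 gives B \<le>
    I. Since I - B = A/c, a root of I - B times \<open>sqrt c\<close> is a root of A.\<close>
  define B where "B = 1\<^sub>m d - (1 / c) \<cdot>\<^sub>m A"
  have B_car: "B \<in> carrier_mat d d" using car by (auto simp: B_def intro!: minus_carrier_mat)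
  have Bv: "v \<bullet> (B *\<^sub>v v) = v \<bullet> v - v \<bullet> (A *\<^sub>v v) / c" if v: "v \<in> carrier_vec d" for v
  proof -
    have "(1 / c) \<cdot>\<^sub>m A *\<^sub>v v = (1 / c) \<cdot>\<^sub>v (A *\<^sub>v v)"
      using car v by (intro eq_vecI) auto
    then have "B *\<^sub>v v = v - (1 / c) \<cdot>\<^sub>v (A *\<^sub>v v)"
      using car v by (simp add: B_def minus_mult_distrib_mat_vec[of _ d d])
    then show ?thesis
      using car v by (simp add: scalar_prod_minus_distrib[of _ d])
  qed
  have "B \<in> symmetric_mats d"
    using car symmetric_mats_index[OF sym]
    by (auto simp: symmetric_mats_def B_def intro!: eq_matI)
  moreover have "v \<bullet> (A *\<^sub>v v) / c \<le> v \<bullet> v" if "v \<in> carrier_vec d" for v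
    using bound[OF that] c by (simp add: pos_divide_le_eq mult.commute)
  ultimately have "B \<in> psd_mats d"
    using Bv by (simp add: psd_mats_def)
  moreover have "v \<bullet> (B *\<^sub>v v) \<le> v \<bullet> v" if "v \<in> carrier_vec d" for v
    using Bv[OF that] A that c by (auto simp: psd_mats_def)
  ultimately obtain S where S: "S \<in> symmetric_mats d" "S * S = 1\<^sub>m d - B"
    using ex_sqrt_one_minus by blast
  have S_car: "S \<in> carrier_mat d d" using S(1) by (simp add: symmetric_mats_def)
  have "(sqrt c \<cdot>\<^sub>m S) * (sqrt c \<cdot>\<^sub>m S) = c \<cdot>\<^sub>m (S * S)"
  proof -
    have "(sqrt c \<cdot>\<^sub>m S) * (sqrt c \<cdot>\<^sub>m S) = (sqrt c * sqrt c) \<cdot>\<^sub>m (S * S)"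
      using S_car by (intro eq_matI) auto
    then show ?thesis using c by simp
  qed
  also have "\<dots> = A"
    using c car unfolding S(2) B_def by (intro eq_matI) auto
  finally have "(sqrt c \<cdot>\<^sub>m S) * (sqrt c \<cdot>\<^sub>m S) = A" .
  moreover have "sqrt c \<cdot>\<^sub>m S \<in> symmetric_mats d"
    using S_car symmetric_mats_index[OF S(1)]
    by (auto simp: symmetric_mats_def intro!: eq_matI)
  ultimately show ?thesis by blast
qed

text \<open>Moving one factor across the scalar product turns the quadratic form into the squared
  norm of Sv.\<close>

lemma symmetric_mats_square_psd:
  assumes S: "S \<in> symmetric_mats d"
  shows "S * S \<in> psd_mats d"
proof -
  have car: "S \<in> carrier_mat d d" using S by (simp add: symmetric_mats_def)
  have "S * S \<in> symmetric_mats d"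
    using S transpose_mult[OF car car] by (auto simp: symmetric_mats_def)
  moreover have "v \<bullet> (S * S *\<^sub>v v) \<ge> 0" if v: "v \<in> carrier_vec d" for v
  proof -
    have "v \<bullet> (S * S *\<^sub>v v) = (S *\<^sub>v v) \<bullet> (S *\<^sub>v v)"
      using car v symmetric_mats_scalar_prod[OF S v, of "S *\<^sub>v v"] by simp
    then show ?thesis using scalar_prod_self_nonneg by simp
  qed
  ultimately show ?thesis by (simp add: psd_mats_def)
qed

lemma pow_mat_two:
  fixes A :: "'a :: semiring_1 mat"
  assumes "A \<in> carrier_mat d d"
  shows "A ^\<^sub>m 2 = A * A"
  using assms by (simp add: numeral_2_eq_2)

section \<open>Traces and the dual cone\<close>

lemma trace_inner_eq_sum:
  assumes "X \<in> carrier_mat d e" "Y \<in> carrier_mat e d"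
  shows "trace_inner X Y = (\<Sum>i<d. \<Sum>j<e. X $$ (i, j) * Y $$ (j, i))"
  using assms by (auto simp: trace_inner_def mat_trace_def scalar_prod_def lessThan_atLeast0
      intro!: sum.cong)

lemma trace_inner_commute:
  assumes "X \<in> carrier_mat d e" "Y \<in> carrier_mat e d"
  shows "trace_inner X Y = trace_inner Y X"
  unfolding trace_inner_eq_sum[OF assms] trace_inner_eq_sum[OF assms(2,1)]
  by (subst sum.swap) (simp add: mult.commute)

text \<open>The carrier claim is carried through the induction because splitting the trace of a sum
  of two matrices requires matching dimensions.\<close>

lemma mat_trace_mat_sum:
  assumes "finite I" "\<And>x. x \<in> I \<Longrightarrow> f x \<in> carrier_mat d d"
  shows "mat_sum d f I \<in> carrier_mat d d \<and> mat_trace (mat_sum d f I) = (\<Sum>x\<in>I. mat_trace (f x))"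
  using assms
proof (induction rule: finite_induct)
  case empty
  interpret abelian_group "module_mat TYPE(real) d d" by (rule abelian_group_mat)
  show ?case by (simp add: mat_sum_def mat_trace_def module_mat_simps)
next
  case (insert x F)
  interpret abelian_group "module_mat TYPE(real) d d" by (rule abelian_group_mat)
  have "mat_sum d f (insert x F) = f x + mat_sum d f F"
    using insert.hyps insert.prems
    by (simp add: mat_sum_def finsum_insert Pi_def module_mat_simps)
  moreover have "mat_sum d f F \<in> carrier_mat d d"
      "mat_trace (mat_sum d f F) = (\<Sum>x\<in>F. mat_trace (f x))"
    using insert.IH insert.prems by auto
  ultimately show ?case
    using insert.hyps insert.prems by (auto simp: mat_trace_def sum.distrib)
qed

text \<open>Linearity of the trace turns the matrix expression of condition (ii) into the scalar sum
  of condition (i), evaluated at the squares.\<close>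

lemma mat_trace_mat_sum_squares:
  assumes "\<And>i. i < n \<Longrightarrow> X i \<in> carrier_mat d d"
  shows "mat_trace (mat_sum d (\<lambda>(i, j). M $$ (i, j) \<cdot>\<^sub>m (X i ^\<^sub>m 2 * X j ^\<^sub>m 2)) ({..<n} \<times> {..<n}))
    = (\<Sum>i<n. \<Sum>j<n. M $$ (i, j) * trace_inner (X i * X i) (X j * X j))"
proof -
  have "mat_trace (mat_sum d (\<lambda>(i, j). M $$ (i, j) \<cdot>\<^sub>m (X i ^\<^sub>m 2 * X j ^\<^sub>m 2)) ({..<n} \<times> {..<n}))
    = (\<Sum>(i, j)\<in>{..<n} \<times> {..<n}. mat_trace (M $$ (i, j) \<cdot>\<^sub>m (X i ^\<^sub>m 2 * X j ^\<^sub>m 2)))"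
    using assms by (subst mat_trace_mat_sum[THEN conjunct2])
      (auto intro!: smult_carrier_mat mult_carrier_mat pow_carrier_mat simp: case_prod_beta)
  also have "\<dots> = (\<Sum>(i, j)\<in>{..<n} \<times> {..<n}. M $$ (i, j) * trace_inner (X i * X i) (X j * X j))"
  proof (intro sum.cong refl, clarify)
    fix i j assume "i < n" "j < n"
    then have "X i \<in> carrier_mat d d" "X j \<in> carrier_mat d d" using assms by auto
    then show "mat_trace (M $$ (i, j) \<cdot>\<^sub>m (X i ^\<^sub>m 2 * X j ^\<^sub>m 2))
        = M $$ (i, j) * trace_inner (X i * X i) (X j * X j)"
      by (simp add: pow_mat_two mat_trace_def trace_inner_def sum_distrib_left)
  qed
  finally show ?thesis by (simp add: sum.cartesian_product)
qed

lemma cpsd_dual_cone_iff: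
  assumes M: "M \<in> symmetric_mats n"
  shows "M \<in> cpsd_dual_cone n \<longleftrightarrow>
    (\<forall>d \<ge> 1. \<forall>X :: nat \<Rightarrow> real mat. (\<forall>i < n. X i \<in> psd_mats d) \<longrightarrow>
      (\<Sum>i<n. \<Sum>j<n. M $$ (i, j) * trace_inner (X i) (X j)) \<ge> 0)" (is "_ \<longleftrightarrow> ?R")
proof -
  \<comment> \<open>The trace pairs the (i, j) entry of M with the (j, i) entry of A; symmetry of A
    swaps the indices back.\<close>
  have inner: "trace_inner M A = (\<Sum>i<n. \<Sum>j<n. M $$ (i, j) * A $$ (i, j))"
    if "A \<in> symmetric_mats n" for A
    using M that symmetric_mats_index[OF that]
    by (subst trace_inner_eq_sum[of _ n n]) (auto simp: symmetric_mats_def)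
  show ?thesis
  proof
    assume dual: "M \<in> cpsd_dual_cone n"
    show ?R
    proof (intro allI impI)
      fix d and X :: "nat \<Rightarrow> real mat"
      assume d: "d \<ge> 1" and X: "\<forall>i<n. X i \<in> psd_mats d"
      \<comment> \<open>The Gram matrix of the family is the member of the cone against which M is
        tested; commutativity of the trace product makes it symmetric.\<close>
      define A where "A = mat n n (\<lambda>(i, j). trace_inner (X i) (X j))"
      have "trace_inner (X i) (X j) = trace_inner (X j) (X i)" if "i < n" "j < n" for i j
        using X that by (intro trace_inner_commute[of _ d d]) (auto simp: psd_mats_def symmetric_mats_def)
      then have A: "A \<in> symmetric_mats n"
        by (auto simp: symmetric_mats_def A_def intro!: eq_matI)
      then have "A \<in> cpsd_cone n"
        using d X unfolding cpsd_cone_def A_def by auto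
      then have "trace_inner M A \<ge> 0"
        using dual by (simp add: cpsd_dual_cone_def)
      then show "(\<Sum>i<n. \<Sum>j<n. M $$ (i, j) * trace_inner (X i) (X j)) \<ge> 0"
        using inner[OF A] by (simp add: A_def)
    qed
  next
    assume R: ?R
    have "trace_inner M A \<ge> 0" if A: "A \<in> cpsd_cone n" for A
    proof -
      obtain d X where "d \<ge> 1" "\<forall>i<n. X i \<in> psd_mats d" "A \<in> symmetric_mats n"
        and "\<forall>i<n. \<forall>j<n. A $$ (i, j) = trace_inner (X i) (X j)"
        using A by (auto simp: cpsd_cone_def)
      then show ?thesis using R inner by simp
    qed
    then show "M \<in> cpsd_dual_cone n" using M by (simp add: cpsd_dual_cone_def)
  qed
qed

theorem lemma3p13:
  fixes n :: nat and M :: "real mat"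
  assumes "M \<in> symmetric_mats n"
  shows "(M \<in> cpsd_dual_cone n \<longleftrightarrow>
           (\<forall>d \<ge> 1. \<forall>X :: nat \<Rightarrow> real mat. (\<forall>i < n. X i \<in> psd_mats d) \<longrightarrow>
              (\<Sum>i < n. \<Sum>j < n. M $$ (i, j) * trace_inner (X i) (X j)) \<ge> 0))
       \<and> (M \<in> cpsd_dual_cone n \<longleftrightarrow>
           (\<forall>d \<ge> 1. \<forall>X :: nat \<Rightarrow> real mat. (\<forall>i < n. X i \<in> symmetric_mats d) \<longrightarrow>
              mat_trace (mat_sum d (\<lambda>(i, j). M $$ (i, j) \<cdot>\<^sub>m (X i ^\<^sub>m 2 * X j ^\<^sub>m 2))
                ({..<n} \<times> {..<n})) \<ge> 0))"
    (is "(_ \<longleftrightarrow> ?psd) \<and> (_ \<longleftrightarrow> ?sym)")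
proof -
  have dual: "M \<in> cpsd_dual_cone n \<longleftrightarrow> ?psd"
    by (rule cpsd_dual_cone_iff[OF assms])
  have "?psd \<longleftrightarrow> ?sym"
  proof
    assume psd: ?psd
    show ?sym
    proof (intro allI impI)
      fix d and X :: "nat \<Rightarrow> real mat"
      assume d: "d \<ge> 1" and X: "\<forall>i<n. X i \<in> symmetric_mats d"
      have "(\<Sum>i<n. \<Sum>j<n. M $$ (i, j) * trace_inner (X i * X i) (X j * X j)) \<ge> 0"
        using psd[rule_format, OF d, of "\<lambda>i. X i * X i"] X symmetric_mats_square_psd by blast
      then show "mat_trace (mat_sum d (\<lambda>(i, j). M $$ (i, j) \<cdot>\<^sub>m (X i ^\<^sub>m 2 * X j ^\<^sub>m 2))
          ({..<n} \<times> {..<n})) \<ge> 0"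
        using X by (subst mat_trace_mat_sum_squares) (auto simp: symmetric_mats_def)
    qed
  next
    assume sym: ?sym
    show ?psd
    proof (intro allI impI)
      fix d and X :: "nat \<Rightarrow> real mat"
      assume d: "d \<ge> 1" and X: "\<forall>i<n. X i \<in> psd_mats d"
      \<comment> \<open>The bound on i sits inside the existential, so choice yields a total family
        of roots, constrained only below n.\<close>
      then have "\<forall>i. \<exists>S. i < n \<longrightarrow> S \<in> symmetric_mats d \<and> S * S = X i"
        using psd_mats_ex_sqrt by blast
      then obtain S where S: "\<forall>i<n. S i \<in> symmetric_mats d \<and> S i * S i = X i"
        by metis
      have "0 \<le> mat_trace (mat_sum d (\<lambda>(i, j). M $$ (i, j) \<cdot>\<^sub>m (S i ^\<^sub>m 2 * S j ^\<^sub>m 2))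
          ({..<n} \<times> {..<n}))"
        using sym d S by blast
      also have "\<dots> = (\<Sum>i<n. \<Sum>j<n. M $$ (i, j) * trace_inner (S i * S i) (S j * S j))"
        using S by (intro mat_trace_mat_sum_squares) (auto simp: symmetric_mats_def)
      also have "\<dots> = (\<Sum>i<n. \<Sum>j<n. M $$ (i, j) * trace_inner (X i) (X j))"
        using S by (intro sum.cong) auto
      finally show "(\<Sum>i<n. \<Sum>j<n. M $$ (i, j) * trace_inner (X i) (X j)) \<ge> 0" .
    qed
  qed
  with dual show ?thesis by blast
qed

end
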